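(* Let $p,q$ be distinct primes $\ge3$, $m=pq$, $m'=\lfloor m/2\rfloor$. Let $\mathcal{H}_p,\mathcal{H}_q$, $C_k$, $C'_l$, $q^*$, $p^*$ be as in the context, with $1\in\mathcal{H}_p$ and $1\in\mathcal{H}_q$, and put $\mathcal{H}'_p=\mathcal{H}_p\setminus\{1\}$, $\mathcal{H}'_q=\mathcal{H}_q\setminus\{1\}$. For $k\in\mathcal{H}'_p$ and $l\in\mathcal{H}'_q$ define the linear forms (with the convention $Y_1=0$) $$R_{p,k}=\sum_{j\in C_k}Y_j-\sum_{j\in C_1}Y_j-Y_{(qk)_{red}}+Y_{(qq^*k)_{red}}-Y_{(qq^* )_{red}}+Y_q,$$ $$R_{q,l}=\sum_{j\in C'_l}Y_j-\sum_{j\in C'_1}Y_j-Y_{(pl)_{red}}+Y_{(pp^*l)_{red}}-Y_{(pp^* )_{red}}+Y_p.$$ Then the forms $R_{p,k}$, $k\in\mathcal{H}'_p$, together with the forms $R_{q,l}$, $l\in\mathcal{H}'_q$, are $\mathbb{Q}$-linearly independent (as elements of $\mathbb{Q}Y_2+\dots+\mathbb{Q}Y_{m'}$).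
   Context: For an integer $a\not\equiv0\pmod m$, $a_{red}$ is the unique integer in $\{1,\dots,m'\}$ with $a_{red}\equiv\pm a\pmod m$. $\mathcal{H}_p$ is a set of integers such that every $k\in\mathcal{H}_p$ satisfies $\gcd(k,q)=1$; for every $j\in\{1,\dots,(p-1)/2\}$ there is $k\in\mathcal{H}_p$ with $k\equiv j\pmod p$; and $k\not\equiv\pm k'\pmod p$ for distinct $k,k'\in\mathcal{H}_p$. $\mathcal{H}_q$ is defined symmetrically (elements coprime to $p$, representing each of $1,\dots,(q-1)/2$ modulo $q$, pairwise not congruent up to sign modulo $q$). For $k\in\mathcal{H}_p$, $C_k=\{(kj)_{red}: j\in\{1,\dots,m\},\ j\equiv1\pmod p,\ \gcd(j,q)=1\}$; for $l\in\mathcal{H}_q$, $C'_l=\{(lj)_{red}: j\in\{1,\dots,m\},\ j\equiv1\pmod q,\ \gcd(j,p)=1\}$. $q^*$ is a fixed integer with $qq^*\equiv1\pmod p$, and $p^*$ a fixed integer with $pp^*\equiv1\pmod q$. *)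

theory Defs
  imports Complex_Main "HOL-Number_Theory.Cong" "HOL-Computational_Algebra.Primes" "HOL-Library.Poly_Mapping"
begin

text \<open>
  For \<open>m\<close> odd and \<open>a\<close> not divisible by \<open>m\<close>, the description is satisfied by exactly one \<open>r\<close>.
  If \<open>m\<close> divides \<open>a\<close> (where the mathematical notation is undefined), it is satisfied by none,
  and \<open>red m a\<close> is an unspecified integer that does not depend on \<open>a\<close>.
\<close>

definition red :: "int \<Rightarrow> int \<Rightarrow> int" where
  "red m a = (THE r. r \<in> {1..m div 2} \<and> ([r = a] (mod m) \<or> [r = - a] (mod m)))"

text \<open>
  \<open>sign_reps p q H\<close> is the condition on \<open>H\<^sub>p\<close>, and \<open>sign_reps q p H\<close> the one on \<open>H\<^sub>q\<close>;
  likewise \<open>C p q k\<close> is \<open>C\<^sub>k\<close> and \<open>C q p l\<close> is \<open>C'\<^sub>l\<close>.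
\<close>

definition sign_reps :: "int \<Rightarrow> int \<Rightarrow> int set \<Rightarrow> bool" where
  "sign_reps p q H \<longleftrightarrow>
     (\<forall>k\<in>H. coprime k q) \<and>
     (\<forall>j\<in>{1..(p - 1) div 2}. \<exists>k\<in>H. [k = j] (mod p)) \<and>
     (\<forall>k\<in>H. \<forall>k'\<in>H. k \<noteq> k' \<longrightarrow> \<not> [k = k'] (mod p) \<and> \<not> [k = - k'] (mod p))"

definition C :: "int \<Rightarrow> int \<Rightarrow> int \<Rightarrow> int set" where
  "C p q k = {red (p * q) (k * j) | j. j \<in> {1..p * q} \<and> [j = 1] (mod p) \<and> coprime j q}"

text \<open>
  Linear forms are finitely supported coefficient functions: the coefficient of \<open>Y\<^sub>j\<close> is the
  value at \<open>j\<close>.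
\<close>

type_synonym form = "int \<Rightarrow>\<^sub>0 rat"

definition form_scale :: "rat \<Rightarrow> form \<Rightarrow> form" where
  "form_scale c = Poly_Mapping.map ((*) c)"

lemma lookup_form_scale [simp]: "Poly_Mapping.lookup (form_scale c f) j = c * Poly_Mapping.lookup f j"
  by (simp add: form_scale_def Poly_Mapping.map.rep_eq when_def)

interpretation forms: vector_space form_scale
  by unfold_locales (rule poly_mapping_eqI; simp add: lookup_add algebra_simps)+

definition Y :: "int \<Rightarrow> form" where
  "Y j = (if j = 1 then 0 else Poly_Mapping.single j 1)"

text \<open>
  With \<open>q q\<^sup>* \<equiv> 1 (mod p)\<close>, \<open>R p q q\<^sup>* k\<close> is \<open>R\<^sub>p\<^sub>,\<^sub>k\<close>; exchanging the roles of the primes,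
  \<open>R q p p\<^sup>* l\<close> is \<open>R\<^sub>q\<^sub>,\<^sub>l\<close>. If \<open>p\<close> divides \<open>k\<close>, the two terms with an unspecified
  index \<open>red (p * q) 0\<close> cancel.
\<close>

definition R :: "int \<Rightarrow> int \<Rightarrow> int \<Rightarrow> int \<Rightarrow> form" where
  "R p q qs k =
     (\<Sum>j\<in>C p q k. Y j) - (\<Sum>j\<in>C p q 1. Y j)
       - Y (red (p * q) (q * k)) + Y (red (p * q) (q * qs * k))
       - Y (red (p * q) (q * qs)) + Y q"

end

theory Submission
  imports Defs
begin

text \<open>
  Suppose \<open>\<Sum>k. \<alpha> k * R\<^sub>p\<^sub>,\<^sub>k + \<Sum>l. \<beta> l * R\<^sub>q\<^sub>,\<^sub>l = 0\<close>, and extend by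
  \<open>\<alpha> 1 = - \<Sum>k\<noteq>1. \<alpha> k\<close>, \<open>\<beta> 1 = - \<Sum>l\<noteq>1. \<beta> l\<close>. At an index \<open>a \<noteq> 1\<close> coprime to \<open>p * q\<close> with
  \<open>a \<equiv> \<plusminus>k (mod p)\<close> and \<open>a \<equiv> \<plusminus>l (mod q)\<close>, the coefficient of the sum is \<open>\<alpha> k + \<beta> l\<close>. By the Chinese
  remainder theorem every pair \<open>(k, l)\<close> of units occurs, so \<open>\<alpha>\<close> is constant on the units of \<open>H\<^sub>p\<close>.
  The definition of \<open>H\<^sub>p\<close> allows one further element, divisible by \<open>p\<close>; its coefficient vanishes
  because its form is the only one whose coefficients at the multiples of \<open>p\<close> have a nonzero sum.
  Hence \<open>\<Sum>k. \<alpha> k = 0\<close> forces the constant to be \<open>0\<close>, and likewise for \<open>\<beta>\<close>.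
\<close>

section \<open>Congruence up to sign and the reduction \<open>red\<close>\<close>

definition pm_cong :: "int \<Rightarrow> int \<Rightarrow> int \<Rightarrow> bool" where
  "pm_cong n a b \<longleftrightarrow> [a = b] (mod n) \<or> [a = - b] (mod n)"

lemma cong_uminus_iff: "[- a = b] (mod n) \<longleftrightarrow> [a = - b] (mod n)" for a b n :: int
  by (metis cong_minus_minus_iff minus_minus)

lemma pm_cong_refl [simp]: "pm_cong n a a"
  by (simp add: pm_cong_def)

lemma pm_cong_sym: "pm_cong n a b \<Longrightarrow> pm_cong n b a"
  unfolding pm_cong_def by (metis cong_sym cong_uminus_iff)

lemma pm_cong_trans: "pm_cong n a b \<Longrightarrow> pm_cong n b c \<Longrightarrow> pm_cong n a c"
  unfolding pm_cong_def by (metis cong_trans cong_minus_minus_iff minus_minus)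

lemma pm_cong_dvd_modulus: "pm_cong n a b \<Longrightarrow> d dvd n \<Longrightarrow> pm_cong d a b"
  unfolding pm_cong_def by (metis cong_dvd_modulus)

lemma pm_cong_dvd_iff: "pm_cong n a b \<Longrightarrow> d dvd n \<Longrightarrow> d dvd a \<longleftrightarrow> d dvd b"
  unfolding pm_cong_def by (metis cong_dvd_iff cong_dvd_modulus dvd_minus_iff)

lemma pm_cong_sign:
  assumes "pm_cong n a b"
  obtains s :: int where "s = 1 \<or> s = -1" "[a = s * b] (mod n)"
  using assms that[of 1] that[of "-1"] by (auto simp: pm_cong_def)

text \<open>The modulus divides \<open>r - s\<close> or \<open>r + s\<close>. Since \<open>m\<close>
  is odd, \<open>m div 2\<close> is (m - 1) / 2, so \<open>r + s\<close> lies strictly between 0 and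
  \<open>m\<close>, and only \<open>r - s = 0\<close> remains.\<close>

lemma pm_cong_unique:
  assumes "pm_cong m r s" "r \<in> {1..m div 2}" "s \<in> {1..m div 2}" "odd m"
  shows "r = s"
proof -
  have b: "0 < r + s" "r + s < m" "\<bar>r - s\<bar> < m"
    using assms by (auto elim!: oddE)
  have "m dvd r - s \<or> m dvd r + s"
    using assms(1) by (auto simp: pm_cong_def cong_iff_dvd_diff)
  then show ?thesis
    using b zdvd_not_zless[of "r + s" m] dvd_imp_le_int[of "r - s" m] by auto
qed

lemma red_eqI:
  assumes "r \<in> {1..m div 2}" "pm_cong m r a" "odd m"
  shows "red m a = r"
  unfolding red_def
proof (rule the_equality)
  show "r \<in> {1..m div 2} \<and> ([r = a] (mod m) \<or> [r = - a] (mod m))"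
    using assms by (simp add: pm_cong_def)
next
  fix s
  assume "s \<in> {1..m div 2} \<and> ([s = a] (mod m) \<or> [s = - a] (mod m))"
  then have "pm_cong m s a" "s \<in> {1..m div 2}"
    by (auto simp: pm_cong_def)
  then show "s = r"
    using assms pm_cong_unique pm_cong_sym pm_cong_trans by blast
qed

text \<open>The predicate under \<open>THE\<close> depends only on the residue class of its
  argument. This covers multiples of \<open>m\<close> too, so two unspecified indices agree and can
  cancel.\<close>

lemma red_cong:
  assumes "[a = b] (mod m)"
  shows "red m a = red m b"
proof -
  have "[- a = - b] (mod m)" using assms by (simp add: cong_minus_minus_iff)
  with assms have "[r = a] (mod m) \<longleftrightarrow> [r = b] (mod m)" "[r = - a] (mod m) \<longleftrightarrow> [r = - b] (mod m)" for r
    by (auto simp: cong_def)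
  then show ?thesis unfolding red_def by presburger
qed

lemma
  assumes "odd m" "m > 0" "\<not> m dvd a"
  shows red_range: "red m a \<in> {1..m div 2}" and pm_cong_red: "pm_cong m (red m a) a"
proof -
  define r where "r = (if a mod m \<le> m div 2 then a mod m else m - a mod m)"
  have "a mod m \<noteq> 0" "0 \<le> a mod m" "a mod m < m"
    using assms by auto
  then have r: "r \<in> {1..m div 2}"
    using assms(1) by (auto simp: r_def elim!: oddE)
  have "pm_cong m r a"
    by (auto simp: r_def pm_cong_def cong_def mod_simps)
  with r assms have "red m a = r" by (intro red_eqI)
  then show "red m a \<in> {1..m div 2}" "pm_cong m (red m a) a"
    using r \<open>pm_cong m r a\<close> by auto
qed

section \<open>Coefficients of linear forms and independence of indexed families\<close>

lemma lookup_Y: "Poly_Mapping.lookup (Y j) a = of_bool (j = a \<and> a \<noteq> 1)"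
  by (auto simp: Y_def lookup_single when_def)

lemma lookup_sum_form: "Poly_Mapping.lookup (\<Sum>i\<in>A. f i) a = (\<Sum>i\<in>A. Poly_Mapping.lookup (f i) a)"
  by (induction A rule: infinite_finite_induct) (simp_all add: lookup_add)

lemma lookup_sum_Y:
  assumes "finite A"
  shows "Poly_Mapping.lookup (\<Sum>j\<in>A. Y j) a = of_bool (a \<in> A \<and> a \<noteq> 1)"
proof -
  have "Poly_Mapping.lookup (\<Sum>j\<in>A. Y j) a = (\<Sum>j\<in>A. if j = a then of_bool (a \<noteq> 1) else 0)"
    unfolding lookup_sum_form by (intro sum.cong) (auto simp: lookup_Y)
  with assms show ?thesis by simp
qed

text \<open>Independence of the image alone would overlook repeated vectors. If
  \<open>F i = F j\<close> with \<open>i \<noteq> j\<close>, the coefficients 1 and -1 give a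
  nontrivial relation, so injectivity follows from the same hypothesis.\<close>

lemma (in vector_space) independent_familyI:
  assumes "finite I"
    and "\<And>c i. (\<Sum>i\<in>I. scale (c i) (F i)) = 0 \<Longrightarrow> i \<in> I \<Longrightarrow> c i = 0"
  shows "inj_on F I \<and> independent (F ` I)"
proof
  show inj: "inj_on F I"
  proof (rule inj_onI, rule ccontr)
    fix i j
    assume ij: "i \<in> I" "j \<in> I" "F i = F j" "i \<noteq> j"
    define c where "c x = (if x = i then 1 else if x = j then -1 else 0 :: 'a)" for x
    have "(\<Sum>x\<in>I. scale (c x) (F x)) = (\<Sum>x\<in>{i, j}. scale (c x) (F x))"
      using ij \<open>finite I\<close> by (intro sum.mono_neutral_right) (auto simp: c_def)
    also have "\<dots> = 0" using ij by (simp add: c_def)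
    finally show False using assms(2)[of c i] ij by (simp add: c_def)
  qed
  show "independent (F ` I)"
  proof (rule independent_if_scalars_zero)
    fix u v
    assume "(\<Sum>x\<in>F ` I. scale (u x) x) = 0" "v \<in> F ` I"
    then show "u v = 0"
      using assms(2)[of "u \<circ> F"] by (auto simp: sum.reindex[OF inj])
  qed (use \<open>finite I\<close> in simp)
qed

section \<open>Systems of representatives up to sign\<close>

lemma sign_reps_unique:
  "sign_reps p q H \<Longrightarrow> k \<in> H \<Longrightarrow> k' \<in> H \<Longrightarrow> pm_cong p k k' \<Longrightarrow> k = k'"
  by (auto simp: sign_reps_def pm_cong_def)

lemma sign_reps_coprime: "sign_reps p q H \<Longrightarrow> k \<in> H \<Longrightarrow> coprime k q"
  by (auto simp: sign_reps_def)

lemma sign_reps_finite: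
  assumes "sign_reps p q H" "p > 0"
  shows "finite H"
proof (rule inj_on_finite)
  show "inj_on (\<lambda>k. k mod p) H"
    using assms(1) by (auto simp: inj_on_def sign_reps_def cong_def)
  show "(\<lambda>k. k mod p) ` H \<subseteq> {0..<p}" using assms(2) by auto
qed simp

lemma sign_reps_exists:
  assumes "sign_reps p q H" "odd p" "p > 0" "\<not> p dvd a"
  obtains k where "k \<in> H" "pm_cong p a k"
proof -
  have "p div 2 = (p - 1) div 2" using \<open>odd p\<close> by (auto elim!: oddE)
  then have "red p a \<in> {1..(p - 1) div 2}"
    using red_range[of p a] assms by simp
  then obtain k where "k \<in> H" "[k = red p a] (mod p)"
    using assms(1) unfolding sign_reps_def by blast
  moreover from this have "pm_cong p k (red p a)" by (simp add: pm_cong_def)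
  moreover have "pm_cong p (red p a) a" using assms by (intro pm_cong_red)
  ultimately show ?thesis
    using that pm_cong_sym pm_cong_trans by blast
qed

lemma sign_reps_sum:
  assumes "sign_reps p q H" "finite H" "k \<in> H" "pm_cong p a k"
  shows "(\<Sum>k\<in>H. f k * of_bool (pm_cong p a k)) = (f k :: rat)"
proof -
  have "pm_cong p a j \<longleftrightarrow> j = k" if "j \<in> H" for j
    using sign_reps_unique[OF assms(1) that assms(3)] assms(4) pm_cong_sym pm_cong_trans by blast
  then have "(\<Sum>j\<in>H. f j * of_bool (pm_cong p a j)) = (\<Sum>j\<in>H. if j = k then f k else 0)"
    by (intro sum.cong) auto
  then show ?thesis using assms by simp
qed

section \<open>Two odd primes: membership in \<open>C\<close> and coefficients of
  \<open>R\<close>\<close>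

locale two_odd_primes =
  fixes p q :: int
  assumes prime_p: "prime p" and prime_q: "prime q" and neq: "p \<noteq> q"
    and p_ge: "p \<ge> 3" and q_ge: "q \<ge> 3"
begin

lemma swap: "two_odd_primes q p"
  using prime_p prime_q neq p_ge q_ge by unfold_locales auto

lemma coprime_pq: "coprime p q"
  using prime_p prime_q neq primes_coprime by blast

lemma odd_p: "odd p"
  using prime_p p_ge prime_odd_int by auto

lemma odd_q: "odd q"
  using prime_q q_ge prime_odd_int by auto

lemma odd_pq: "odd (p * q)"
  using odd_p odd_q by simp

lemma pq_pos: "p * q > 0"
  using p_ge q_ge by simp

lemma coprime_p_iff: "coprime a p \<longleftrightarrow> \<not> p dvd a"
  using prime_p by (metis coprime_commute prime_imp_coprime coprime_absorb_left not_prime_unit)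

lemma coprime_q_iff: "coprime a q \<longleftrightarrow> \<not> q dvd a"
  using two_odd_primes.coprime_p_iff[OF swap] .

lemma pq_dvd_iff: "p * q dvd a \<longleftrightarrow> p dvd a \<and> q dvd a"
  using coprime_pq by (meson divides_mult dvd_mult_left dvd_mult_right)

lemma p_dvd_mult: "p dvd a * b \<longleftrightarrow> p dvd a \<or> p dvd b"
  using prime_p prime_dvd_mult_iff by blast

lemma q_dvd_mult: "q dvd a * b \<longleftrightarrow> q dvd a \<or> q dvd b"
  using prime_q prime_dvd_mult_iff by blast

lemma not_p_dvd_q: "\<not> p dvd q"
  using coprime_pq coprime_p_iff by (metis coprime_commute)

lemma not_q_dvd_p: "\<not> q dvd p"
  using two_odd_primes.not_p_dvd_q[OF swap] .

lemma pq_red: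
  assumes "\<not> p dvd a \<or> \<not> q dvd a"
  shows "red (p * q) a \<in> {1..p * q div 2}" "pm_cong (p * q) (red (p * q) a) a"
  using red_range[OF odd_pq pq_pos] pm_cong_red[OF odd_pq pq_pos] assms by (auto simp: pq_dvd_iff)

lemma q_range: "q \<in> {1..p * q div 2}"
proof -
  have "3 * q \<le> p * q" using p_ge q_ge by (intro mult_right_mono) auto
  then have "q \<le> p * q div 2" using q_ge by linarith
  then show ?thesis using q_ge by simp
qed

lemma finite_C: "finite (C p q k)"
  unfolding C_def by (rule finite_subset[of _ "(\<lambda>j. red (p * q) (k * j)) ` {1..p * q}"]) auto

text \<open>The factor \<open>j\<close> is 1 modulo \<open>p\<close> and any unit modulo
  \<open>q\<close>. As \<open>k\<close> is a unit modulo \<open>q\<close>, the product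
  \<open>k * j\<close> is fixed modulo \<open>p\<close> and runs through all units modulo
  \<open>q\<close>. The argument includes the case that \<open>p\<close> divides
  \<open>k\<close>.\<close>

lemma mem_C_iff:
  assumes "coprime k q"
  shows "a \<in> C p q k \<longleftrightarrow> a \<in> {1..p * q div 2} \<and> \<not> q dvd a \<and> pm_cong p a k"
proof
  assume "a \<in> C p q k"
  then obtain j where j: "a = red (p * q) (k * j)" "[j = 1] (mod p)" "coprime j q"
    by (auto simp: C_def)
  have kj: "\<not> q dvd k * j"
    using j assms by (simp add: q_dvd_mult coprime_q_iff)
  then have a: "a \<in> {1..p * q div 2}" "pm_cong (p * q) a (k * j)"
    using pq_red[of "k * j"] j(1) by auto
  have "pm_cong p a (k * j)" using pm_cong_dvd_modulus[OF a(2)] by simp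
  moreover have "pm_cong p (k * j) k"
    using cong_scalar_left[OF j(2), of k] by (simp add: pm_cong_def)
  ultimately show "a \<in> {1..p * q div 2} \<and> \<not> q dvd a \<and> pm_cong p a k"
    using a kj pm_cong_dvd_iff[OF a(2), of q] pm_cong_trans by auto
next
  assume a: "a \<in> {1..p * q div 2} \<and> \<not> q dvd a \<and> pm_cong p a k"
  then obtain s where s: "s = 1 \<or> s = -1" "[a = s * k] (mod p)"
    using pm_cong_sign by blast
  have s2: "s * s = 1" using s(1) by auto
  obtain k' where k': "[k * k' = 1] (mod q)"
    using cong_solve_coprime_int[OF assms] by auto
  \<comment> \<open>The choice makes \<open>k * x\<close> congruent to \<open>s * a\<close> modulo
    both primes, with the same sign \<open>s\<close>.\<close>
  obtain x where x: "[x = 1] (mod p)" "[x = s * a * k'] (mod q)"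
    using binary_chinese_remainder_int[OF coprime_pq] by blast
  \<comment> \<open>The range of \<open>j\<close> in \<open>C\<close> is \<open>{1..p * q}\<close>,
    so a residue 0 is represented by \<open>p * q\<close>.\<close>
  define j where "j = (if x mod (p * q) = 0 then p * q else x mod (p * q))"
  have "[j = x] (mod p * q)"
    by (auto simp: j_def cong_def)
  then have jx: "[j = x] (mod p)" "[j = x] (mod q)"
    by (auto intro: cong_dvd_modulus)
  have j_range: "j \<in> {1..p * q}"
    using pq_pos pos_mod_sign[OF pq_pos, of x] pos_mod_bound[OF pq_pos, of x]
    by (auto simp: j_def simp del: pos_mod_sign pos_mod_bound)
  have j1: "[j = 1] (mod p)" using jx(1) x(1) cong_trans by blast
  have jq: "[k * j = s * a] (mod q)"
  proof -
    have "[k * j = k * (s * a * k')] (mod q)"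
      using jx(2) x(2) cong_trans cong_scalar_left by blast
    also have "k * (s * a * k') = (s * a) * (k * k')" by (simp add: algebra_simps)
    also have "[(s * a) * (k * k') = (s * a) * 1] (mod q)"
      using k' cong_scalar_left by blast
    finally show ?thesis by simp
  qed
  have "\<not> q dvd k * j"
    using cong_dvd_iff[OF jq] a s(1) by auto
  then have "coprime j q" by (simp add: q_dvd_mult coprime_q_iff)
  have "[k * j = s * a] (mod p)"
  proof -
    have "[k * j = k * 1] (mod p)" using j1 cong_scalar_left by blast
    also have "k * 1 = s * (s * k)" using s2 by (simp add: mult.assoc[symmetric])
    also have "[s * (s * k) = s * a] (mod p)"
      using s(2) cong_scalar_left cong_sym by blast
    finally show ?thesis .
  qed
  with jq have "[k * j = s * a] (mod p * q)"
    using coprime_pq coprime_cong_mult by blast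
  then have "pm_cong (p * q) (k * j) a"
    using s(1) by (auto simp: pm_cong_def)
  then have "red (p * q) (k * j) = a"
    using a odd_pq pm_cong_sym by (intro red_eqI) auto
  then show "a \<in> C p q k"
    using j_range j1 \<open>coprime j q\<close> unfolding C_def by blast
qed

text \<open>
  If \<open>p\<close> divides \<open>k\<close>, the two unspecified terms cancel, and \<open>a = b = q\<close> is a valid choice.
\<close>

lemma R_decomp:
  assumes "coprime k q" "[q * qs = 1] (mod p)"
  obtains a b d where "{a, b, d, q} \<subseteq> {x \<in> {1..p * q div 2}. q dvd x}"
    "R p q qs k = (\<Sum>j\<in>C p q k. Y j) - (\<Sum>j\<in>C p q 1. Y j) - Y a + Y b - Y d + Y q"
proof -
  define M where "M = {x \<in> {1..p * q div 2}. q dvd x}"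
  have red_M: "red (p * q) (q * x) \<in> M" if "\<not> p dvd x" for x
  proof -
    have "\<not> p dvd q * x" using that not_p_dvd_q by (simp add: p_dvd_mult)
    then show ?thesis
      using pq_red[of "q * x"] pm_cong_dvd_iff[of "p * q" _ "q * x" q] by (auto simp: M_def)
  qed
  have qqs: "\<not> p dvd q * qs"
    using cong_dvd_iff[OF assms(2)] p_ge by auto
  then have d: "red (p * q) (q * qs) \<in> M" by (intro red_M) auto
  have q: "q \<in> M" using q_range by (simp add: M_def)
  show ?thesis
  proof (cases "p dvd k")
    case True
    then have "[q * k = 0] (mod p * q)" "[q * qs * k = 0] (mod p * q)"
      by (auto simp: cong_0_iff pq_dvd_iff)
    then have "red (p * q) (q * k) = red (p * q) (q * qs * k)"
      using red_cong cong_trans cong_sym by blast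
    then show ?thesis
      using d q by (intro that[of q q "red (p * q) (q * qs)"]) (auto simp: R_def M_def)
  next
    case False
    then have "\<not> p dvd qs * k" using qqs by (auto simp: p_dvd_mult)
    then show ?thesis
      using d q red_M[of k] red_M[of "qs * k"] False
      by (intro that[of "red (p * q) (q * k)" "red (p * q) (q * qs * k)" "red (p * q) (q * qs)"])
        (auto simp: R_def M_def mult.assoc)
  qed
qed

lemma R_span:
  assumes "coprime k q" "[q * qs = 1] (mod p)"
  shows "R p q qs k \<in> forms.span (Y ` {2..p * q div 2})"
proof -
  have Y: "Y j \<in> forms.span (Y ` {2..p * q div 2})" if "j \<in> {1..p * q div 2}" for j
  \<comment> \<open>The spanning set starts at index 2, but \<open>Y 1\<close> is the zero
    form.\<close>
  proof (cases "j = 1")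
    case True
    then show ?thesis by (simp add: Y_def forms.span_zero)
  next
    case False
    then show ?thesis using that by (intro forms.span_base) auto
  qed
  have "(\<Sum>j\<in>C p q x. Y j) \<in> forms.span (Y ` {2..p * q div 2})" if "coprime x q" for x
    using that by (intro forms.span_sum Y) (simp add: mem_C_iff)
  note C = this[OF assms(1)] this[OF coprime_1_left]
  obtain a b d where abd: "{a, b, d, q} \<subseteq> {x \<in> {1..p * q div 2}. q dvd x}"
    and R: "R p q qs k = (\<Sum>j\<in>C p q k. Y j) - (\<Sum>j\<in>C p q 1. Y j) - Y a + Y b - Y d + Y q"
    using R_decomp[OF assms] .
  show ?thesis
    unfolding R using abd by (intro forms.span_add forms.span_diff C Y) auto
qed

text \<open>The four extra terms of \<open>R\<close> sit at multiples of \<open>q\<close>, so away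
  from these only the two sums over \<open>C\<close> contribute.\<close>

lemma lookup_R:
  assumes "coprime k q" "[q * qs = 1] (mod p)" "a \<in> {2..p * q div 2}" "\<not> q dvd a"
  shows "Poly_Mapping.lookup (R p q qs k) a = of_bool (pm_cong p a k) - of_bool (pm_cong p a 1)"
proof -
  obtain b c d where bcd: "{b, c, d, q} \<subseteq> {x \<in> {1..p * q div 2}. q dvd x}"
    and R: "R p q qs k = (\<Sum>j\<in>C p q k. Y j) - (\<Sum>j\<in>C p q 1. Y j) - Y b + Y c - Y d + Y q"
    using R_decomp[OF assms(1,2)] .
  have "a \<notin> {b, c, d, q}" using bcd assms(4) by auto
  then show ?thesis
    using assms unfolding R
    by (auto simp: lookup_add lookup_minus lookup_sum_Y lookup_Y finite_C mem_C_iff)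
qed

text \<open>The sums over \<open>C\<close> avoid multiples of \<open>q\<close>. The extra indices
  are multiples of \<open>q\<close>, hence different from 1, so each \<open>Y\<close> counts fully;
  the signs cancel whichever indices coincide.\<close>

lemma sum_lookup_R:
  assumes "coprime k q" "[q * qs = 1] (mod p)"
  shows "(\<Sum>a | a \<in> {1..p * q div 2} \<and> q dvd a. Poly_Mapping.lookup (R p q qs k) a) = 0"
proof -
  define M where "M = {a \<in> {1..p * q div 2}. q dvd a}"
  obtain b c d where bcd: "{b, c, d, q} \<subseteq> M"
    and R: "R p q qs k = (\<Sum>j\<in>C p q k. Y j) - (\<Sum>j\<in>C p q 1. Y j) - Y b + Y c - Y d + Y q"
    using R_decomp[OF assms] unfolding M_def .
  have fin: "finite M" by (rule finite_subset[of _ "{1..p * q div 2}"]) (auto simp: M_def)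
  have Y: "(\<Sum>a\<in>M. Poly_Mapping.lookup (Y x) a) = 1" if "x \<in> M" for x
  proof -
    have "\<not> q dvd 1" using q_ge by simp
    with that have "x \<noteq> 1" unfolding M_def by blast
    then have "(\<Sum>a\<in>M. Poly_Mapping.lookup (Y x) a) = (\<Sum>a\<in>M. if x = a then 1 else 0)"
      by (intro sum.cong) (auto simp: lookup_Y)
    then show ?thesis using that fin by simp
  qed
  have C: "(\<Sum>a\<in>M. Poly_Mapping.lookup (\<Sum>j\<in>C p q x. Y j) a) = 0" if "coprime x q" for x
    using that by (intro sum.neutral) (auto simp: lookup_sum_Y finite_C mem_C_iff M_def)
  show ?thesis
    using bcd assms(1) unfolding M_def[symmetric] R lookup_add lookup_minus sum.distrib sum_subtractf
    by (simp add: Y C)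
qed

end

section \<open>Consequences of a linear relation between the forms\<close>

locale form_relation = two_odd_primes +
  fixes Hp Hq :: "int set" and ps qs :: int and \<alpha> \<beta> :: "int \<Rightarrow> rat"
  assumes reps_p: "sign_reps p q Hp" and reps_q: "sign_reps q p Hq"
    and one_p: "1 \<in> Hp" and one_q: "1 \<in> Hq"
    and qs: "[q * qs = 1] (mod p)" and ps: "[p * ps = 1] (mod q)"
    and relation: "(\<Sum>k\<in>Hp - {1}. form_scale (\<alpha> k) (R p q qs k))
      + (\<Sum>l\<in>Hq - {1}. form_scale (\<beta> l) (R q p ps l)) = 0"
begin

text \<open>The setting is symmetric in the two primes, so each result on \<open>\<alpha>\<close>
  transfers to \<open>\<beta>\<close>.\<close>

lemma swap_relation: "form_relation q p Hq Hp qs ps \<beta> \<alpha>"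
proof -
  interpret s: two_odd_primes q p by (rule swap)
  show ?thesis
    using reps_p reps_q one_p one_q qs ps relation by unfold_locales (simp_all add: add.commute)
qed

lemma finite_Hp: "finite Hp" and finite_Hq: "finite Hq"
  using sign_reps_finite[OF reps_p] sign_reps_finite[OF reps_q] p_ge q_ge by auto

lemma lookup_relation:
  "(\<Sum>k\<in>Hp - {1}. \<alpha> k * Poly_Mapping.lookup (R p q qs k) a)
    + (\<Sum>l\<in>Hq - {1}. \<beta> l * Poly_Mapping.lookup (R q p ps l) a) = 0"
  using arg_cong[OF relation, of "\<lambda>f. Poly_Mapping.lookup f a"]
  by (simp add: lookup_add lookup_sum_form)

text \<open>
  Summing the coefficients at the multiples of \<open>p\<close> kills \<open>R\<^sub>q\<^sub>,\<^sub>l\<close>, because the signs of its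
  four extra terms add up to \<open>0\<close>.
\<close>

lemma coeff_multiple_p:
  assumes "k \<in> Hp" "p dvd k"
  shows "\<alpha> k = 0"
proof -
  interpret s: two_odd_primes q p by (rule swap)
  define M where "M = {a \<in> {1..p * q div 2}. p dvd a}"
  have p1: "\<not> p dvd 1" using p_ge by simp
  then have "k \<noteq> 1" using assms(2) by auto
  have q0: "(\<Sum>a\<in>M. Poly_Mapping.lookup (R q p ps l) a) = 0" if "l \<in> Hq" for l
    using s.sum_lookup_R[OF sign_reps_coprime[OF reps_q that] ps]
    by (simp add: M_def mult.commute)
  \<comment> \<open>A multiple of \<open>p\<close> in the range is prime to \<open>q\<close>, so
    \<open>lookup_R\<close> applies. It is congruent to \<open>k\<close> modulo \<open>p\<close>,
    and \<open>k\<close> is the only representative in that class.\<close>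
  have p0: "Poly_Mapping.lookup (R p q qs j) a = of_bool (j = k)" if "j \<in> Hp" "a \<in> M" for j a
  proof -
    have a: "a \<in> {1..p * q div 2}" "p dvd a" using that by (auto simp: M_def)
    then have "a \<noteq> 1" using p1 by auto
    then have a2: "a \<in> {2..p * q div 2}" using a by auto
    have "\<not> p * q dvd a"
      using a zdvd_not_zless[of a "p * q"] pq_pos by auto
    then have "\<not> q dvd a" using a by (simp add: pq_dvd_iff)
    have "\<not> pm_cong p a 1" using pm_cong_dvd_iff[of p a 1 p] a p1 by auto
    moreover have "pm_cong p a k" using a assms(2) by (simp add: pm_cong_def cong_iff_dvd_diff)
    then have "pm_cong p a j \<longleftrightarrow> j = k"
      using sign_reps_unique[OF reps_p that(1) assms(1)] pm_cong_sym pm_cong_trans by blast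
    ultimately show ?thesis
      using lookup_R[OF sign_reps_coprime[OF reps_p that(1)] qs a2 \<open>\<not> q dvd a\<close>] by simp
  qed
  have "0 = (\<Sum>a\<in>M. (\<Sum>j\<in>Hp - {1}. \<alpha> j * Poly_Mapping.lookup (R p q qs j) a)
    + (\<Sum>l\<in>Hq - {1}. \<beta> l * Poly_Mapping.lookup (R q p ps l) a))"
    by (simp add: lookup_relation)
  also have "\<dots> = (\<Sum>a\<in>M. \<Sum>j\<in>Hp - {1}. \<alpha> j * Poly_Mapping.lookup (R p q qs j) a)
      + (\<Sum>l\<in>Hq - {1}. \<beta> l * (\<Sum>a\<in>M. Poly_Mapping.lookup (R q p ps l) a))"
    unfolding sum.distrib sum_distrib_left by (subst (2) sum.swap) simp
  also have "(\<Sum>l\<in>Hq - {1}. \<beta> l * (\<Sum>a\<in>M. Poly_Mapping.lookup (R q p ps l) a)) = 0"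
    by (intro sum.neutral) (simp add: q0)
  also have "(\<Sum>a\<in>M. \<Sum>j\<in>Hp - {1}. \<alpha> j * Poly_Mapping.lookup (R p q qs j) a)
      = (\<Sum>a\<in>M. \<Sum>j\<in>Hp - {1}. if j = k then \<alpha> k else 0)"
    by (intro sum.cong refl) (auto simp: p0)
  also have "\<dots> = of_nat (card M) * \<alpha> k"
    using finite_Hp assms(1) \<open>k \<noteq> 1\<close> by simp
  finally have sum_0: "of_nat (card M) * \<alpha> k = 0" by simp
  have "p \<in> M"
    using s.q_range by (simp add: M_def mult.commute)
  moreover have "finite M"
    by (rule finite_subset[of _ "{1..p * q div 2}"]) (auto simp: M_def)
  ultimately have "card M \<noteq> 0" by auto
  with sum_0 show ?thesis by simp
qed

text \<open>Every \<open>R p q qs k\<close> subtracts the sum over \<open>C p q 1\<close>, so the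
  class of 1 collects minus the sum of all coefficients.\<close>

definition \<alpha>' :: "int \<Rightarrow> rat" where
  "\<alpha>' k = (if k = 1 then - (\<Sum>j\<in>Hp - {1}. \<alpha> j) else \<alpha> k)"

lemma sum_\<alpha>': "(\<Sum>k\<in>Hp. \<alpha>' k) = 0"
proof -
  have "(\<Sum>k\<in>Hp. \<alpha>' k) = \<alpha>' 1 + (\<Sum>k\<in>Hp - {1}. \<alpha>' k)"
    using finite_Hp one_p by (rule sum.remove)
  also have "(\<Sum>k\<in>Hp - {1}. \<alpha>' k) = (\<Sum>k\<in>Hp - {1}. \<alpha> k)"
    by (intro sum.cong) (auto simp: \<alpha>'_def)
  finally show ?thesis by (simp add: \<alpha>'_def)
qed

text \<open>With the weight \<open>\<alpha>' 1\<close> for the subtracted class, the coefficient is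
  a sum over all of \<open>Hp\<close> in which only the representative of \<open>a\<close>
  survives.\<close>

lemma sum_lookup_eq:
  assumes "a \<in> {2..p * q div 2}" "\<not> q dvd a" "k \<in> Hp" "pm_cong p a k"
  shows "(\<Sum>k\<in>Hp - {1}. \<alpha> k * Poly_Mapping.lookup (R p q qs k) a) = \<alpha>' k"
proof -
  have "(\<Sum>k\<in>Hp - {1}. \<alpha> k * Poly_Mapping.lookup (R p q qs k) a)
      = (\<Sum>k\<in>Hp - {1}. \<alpha> k * of_bool (pm_cong p a k) - \<alpha> k * of_bool (pm_cong p a 1))"
    using lookup_R[OF sign_reps_coprime[OF reps_p] qs assms(1,2)]
    by (intro sum.cong) (simp_all add: right_diff_distrib)
  also have "\<dots> = \<alpha>' 1 * of_bool (pm_cong p a 1) + (\<Sum>k\<in>Hp - {1}. \<alpha> k * of_bool (pm_cong p a k))"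
    by (simp add: sum_subtractf \<alpha>'_def sum_distrib_right)
  also have "(\<Sum>k\<in>Hp - {1}. \<alpha> k * of_bool (pm_cong p a k))
      = (\<Sum>k\<in>Hp - {1}. \<alpha>' k * of_bool (pm_cong p a k))"
    by (intro sum.cong) (auto simp: \<alpha>'_def)
  also have "\<alpha>' 1 * of_bool (pm_cong p a 1) + \<dots> = (\<Sum>k\<in>Hp. \<alpha>' k * of_bool (pm_cong p a k))"
    using sum.remove[OF finite_Hp one_p, of "\<lambda>k. \<alpha>' k * of_bool (pm_cong p a k)"] by simp
  also have "\<dots> = \<alpha>' k"
    using sign_reps_sum[OF reps_p finite_Hp assms(3,4)] .
  finally show ?thesis .
qed

text \<open>
  The pair of classes of \<open>k\<close> and \<open>l\<close> up to sign lifts to two classes modulo \<open>p * q\<close> up to sign,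
  so at least one of them is not the class of \<open>1\<close>, where the coefficient is lost by \<open>Y\<^sub>1 = 0\<close>.
\<close>

lemma exists_index:
  assumes "\<not> p dvd k" "\<not> q dvd l"
  obtains a where "a \<in> {2..p * q div 2}" "\<not> p dvd a" "\<not> q dvd a" "pm_cong p a k" "pm_cong q a l"
proof -
  obtain x where x: "[x = k] (mod p)" "[x = l] (mod q)"
    using binary_chinese_remainder_int[OF coprime_pq] by blast
  obtain y where y: "[y = k] (mod p)" "[y = - l] (mod q)"
    using binary_chinese_remainder_int[OF coprime_pq] by blast
  have red: "red (p * q) z \<in> {1..p * q div 2}" "pm_cong (p * q) (red (p * q) z) z"
    "\<not> p dvd red (p * q) z" "\<not> q dvd red (p * q) z"
    "pm_cong p (red (p * q) z) k" "pm_cong q (red (p * q) z) l"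
    if z: "[z = k] (mod p)" "[z = l] (mod q) \<or> [z = - l] (mod q)" for z
  proof -
    have zp: "pm_cong p z k" "pm_cong q z l" using z by (auto simp: pm_cong_def)
    then have "\<not> p dvd z" "\<not> q dvd z"
      using assms pm_cong_dvd_iff[of p z k p] pm_cong_dvd_iff[of q z l q] by auto
    then show r: "red (p * q) z \<in> {1..p * q div 2}" "pm_cong (p * q) (red (p * q) z) z"
      using pq_red[of z] by auto
    from r(2) show "pm_cong p (red (p * q) z) k" "pm_cong q (red (p * q) z) l"
      using zp pm_cong_trans pm_cong_dvd_modulus by (meson dvd_triv_left dvd_triv_right)+
    from r(2) show "\<not> p dvd red (p * q) z" "\<not> q dvd red (p * q) z"
      using \<open>\<not> p dvd z\<close> \<open>\<not> q dvd z\<close> pm_cong_dvd_iff[OF r(2), of p] pm_cong_dvd_iff[OF r(2), of q]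
      by auto
  qed
  have "red (p * q) x \<noteq> 1 \<or> red (p * q) y \<noteq> 1"
  proof (rule ccontr)
    assume "\<not> ?thesis"
    then have "pm_cong (p * q) x 1" "pm_cong (p * q) y 1"
      using red(2)[of x] red(2)[of y] x y pm_cong_sym by auto
    then have "pm_cong (p * q) x y"
      using pm_cong_sym pm_cong_trans by blast
    then obtain s where s: "s = 1 \<or> s = -1" "[x = s * y] (mod p * q)"
      using pm_cong_sign by blast
    have "[x = s * y] (mod p)" "[x = s * y] (mod q)"
      using s(2) cong_dvd_modulus by (meson dvd_triv_left dvd_triv_right)+
    \<comment> \<open>The two lifts agree modulo \<open>p\<close> and are opposite modulo
      \<open>q\<close>: \<open>k\<close> forces \<open>s\<close> to be 1 modulo \<open>p\<close>,
      \<open>l\<close> forces it to be -1 modulo \<open>q\<close>. Either value of \<open>s\<close>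
      makes an odd prime divide 2.\<close>
    then have "[k = s * k] (mod p)" "[l = s * (- l)] (mod q)"
      using x y cong_trans cong_sym cong_scalar_left by meson+
    then have "p dvd k * (1 - s)" "q dvd l * (1 + s)"
      by (simp_all add: cong_iff_dvd_diff algebra_simps)
    then have "p dvd 1 - s" "q dvd 1 + s"
      using assms by (auto simp: p_dvd_mult q_dvd_mult)
    then have "p dvd 2 \<or> q dvd 2" using s(1) by auto
    then show False using p_ge q_ge zdvd_not_zless[of 2] by auto
  qed
  then show ?thesis
  proof
    assume "red (p * q) x \<noteq> 1"
    then show ?thesis using red[of x] x that[of "red (p * q) x"] by auto
  next
    assume "red (p * q) y \<noteq> 1"
    then show ?thesis using red[of y] y that[of "red (p * q) y"] by auto
  qed
qed

text \<open>The relation is read off at one index lying in both classes;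
  \<open>form_relation.\<alpha>' Hq \<beta>\<close> is \<open>\<alpha>'\<close> with the primes
  exchanged.\<close>

lemma coeffs_opposite:
  assumes "k \<in> Hp" "\<not> p dvd k" "l \<in> Hq" "\<not> q dvd l"
  shows "\<alpha>' k + form_relation.\<alpha>' Hq \<beta> l = 0"
proof -
  interpret s: form_relation q p Hq Hp qs ps \<beta> \<alpha> by (rule swap_relation)
  obtain a where "a \<in> {2..p * q div 2}" "\<not> p dvd a" "\<not> q dvd a" "pm_cong p a k" "pm_cong q a l"
    using exists_index assms by blast
  then show ?thesis
    using lookup_relation[of a] sum_lookup_eq[of a k] s.sum_lookup_eq[of a l] assms
    by (simp add: mult.commute)
qed

lemma coeff_unit_eq_0:
  assumes "k \<in> Hp" "\<not> p dvd k"
  shows "\<alpha>' k = 0"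
proof -
  define c where "c = form_relation.\<alpha>' Hq \<beta> 1"
  have "\<not> q dvd 1" using q_ge by simp
  \<comment> \<open>Pairing every unit \<open>j\<close> with the same \<open>l = 1\<close> makes
    \<open>\<alpha>'\<close> constant on the units.\<close>
  then have unit: "\<alpha>' j = - c" if "j \<in> Hp" "\<not> p dvd j" for j
    using coeffs_opposite[OF that one_q] by (simp add: c_def)
  have p1: "\<not> p dvd 1" using p_ge by simp
  define U where "U = {j \<in> Hp. \<not> p dvd j}"
  \<comment> \<open>An element divisible by \<open>p\<close> differs from 1, so its
    \<open>\<alpha>'\<close> is its \<open>\<alpha>\<close>, which vanishes.\<close>
  have "(\<Sum>j\<in>Hp. \<alpha>' j) = (\<Sum>j\<in>U. \<alpha>' j)"
    using finite_Hp p1 coeff_multiple_p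
    by (intro sum.mono_neutral_right) (auto simp: U_def \<alpha>'_def)
  also have "\<dots> = - (of_nat (card U) * c)"
    by (simp add: U_def unit)
  finally have "of_nat (card U) * c = 0" using sum_\<alpha>' by simp
  moreover have "card U \<noteq> 0" using finite_Hp one_p p1 by (auto simp: U_def)
  ultimately show ?thesis using unit assms by simp
qed

lemma coeff_eq_0:
  assumes "k \<in> Hp - {1}"
  shows "\<alpha> k = 0"
  using assms coeff_multiple_p[of k] coeff_unit_eq_0[of k] by (auto simp: \<alpha>'_def)

end

theorem theorem3:
  fixes p q ps qs :: int and Hp Hq :: "int set"
  assumes "prime p" "prime q" "p \<noteq> q" "p \<ge> 3" "q \<ge> 3"
    and "sign_reps p q Hp" "sign_reps q p Hq"
    and "1 \<in> Hp" "1 \<in> Hq"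
    and "[q * qs = 1] (mod p)" "[p * ps = 1] (mod q)"
  defines "I \<equiv> (Hp - {1}) <+> (Hq - {1})"
    and "F \<equiv> case_sum (R p q qs) (R q p ps)"
  shows "F ` I \<subseteq> forms.span (Y ` {2..p * q div 2})
    \<and> inj_on F I \<and> forms.independent (F ` I)"
proof (intro conjI)
  interpret t: two_odd_primes p q using assms by unfold_locales
  interpret s: two_odd_primes q p by (rule t.swap)
  show "F ` I \<subseteq> forms.span (Y ` {2..p * q div 2})"
    using t.R_span[OF sign_reps_coprime[OF assms(6)] assms(10)]
      s.R_span[OF sign_reps_coprime[OF assms(7)] assms(11)]
    by (auto simp: I_def F_def mult.commute[of q p])
  have fin: "finite Hp" "finite Hq"
    using assms sign_reps_finite[of p q Hp] sign_reps_finite[of q p Hq] by auto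
  have "inj_on F I \<and> forms.independent (F ` I)"
  proof (rule forms.independent_familyI)
    show "finite I" using fin by (simp add: I_def)
    fix c i
    assume rel: "(\<Sum>i\<in>I. form_scale (c i) (F i)) = 0" and i: "i \<in> I"
    \<comment> \<open>The sum over the disjoint union splits into the two families, with
      \<open>c\<close> restricted to each summand as \<open>\<alpha>\<close> and
      \<open>\<beta>\<close>.\<close>
    have "(\<Sum>k\<in>Hp - {1}. form_scale (c (Inl k)) (R p q qs k))
      + (\<Sum>l\<in>Hq - {1}. form_scale (c (Inr l)) (R q p ps l)) = 0"
      using rel fin by (simp add: I_def F_def sum.Plus)
    then interpret r: form_relation p q Hp Hq ps qs "c \<circ> Inl" "c \<circ> Inr"
      using assms by unfold_locales auto
    interpret r': form_relation q p Hq Hp qs ps "c \<circ> Inr" "c \<circ> Inl"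
      by (rule r.swap_relation)
    show "c i = 0"
      using i r.coeff_eq_0 r'.coeff_eq_0 by (auto simp: I_def)
  qed
  then show "inj_on F I" "forms.independent (F ` I)" by auto
qed

end
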